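(* Let $\mathcal X=\mathbb{R}^d$ and let $X^\theta$ be a random variable with probability density $f(\cdot,\theta)$, $f:\mathcal X\times\Theta\to\mathbb{R}$. Assume the following. (i) For any $\theta'\in\Theta$, $\nabla_\theta\,\mathbb{E}[h(X^{\theta'},\theta)]=\mathbb{E}[\dot h(X^{\theta'},\theta)]$, and the function $\theta\mapsto\mathbb{E}[\dot h(X^\theta,\theta)]$ is continuous. (ii) There exists a diagonal matrix $\Gamma_n=\mathrm{diag}(\gamma_n^{(1)},\dots,\gamma_n^{(p)})$ with $\gamma_n^{(k)}>0$ and $\gamma_{n*}:=\max_{1\le k\le p}\gamma_n^{(k)}\downarrow0$ as $n\to\infty$ such that, as $n\to\infty$, $\Gamma_n^{-1}(\widehat\theta_n-\theta_0)\xrightarrow{d}Z$ and $\gamma_{n*}^{-1}(\widehat\theta_n-\theta_0)\xrightarrow{d}Z^*$ for $p$-dimensional random variables $Z$ and $Z^*$. (iii) $f$ is twice differentiable with respect to $\theta\in\Theta$, with first derivative $\dot f$ and second derivative $\ddot f$ in $\theta$; $\int_{\mathcal X}h(x,\theta_0)\dot f(x,\theta_0)\,dx<\infty$ (i.e. the integral is finite); and $$\sup_{\theta\in\Theta}\left|\int_{\mathcal X}h(x,\theta_0)\ddot f(x,\theta)\,dx\right|<\infty .$$ Then $$\gamma_{n*}^{-1}\,\mathbb{E}\left[h(X^{\theta},\theta_0)-h(X^{\theta_0},\theta_0)\right]\Big|_{\theta=\widehat\theta_n}=C_{\theta_0}^\top\gamma_{n*}^{-1}(\widehat\theta_n-\theta_0)+o_p(1),\quad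 n\to\infty,$$ holds with $C_{\theta_0}=\int_{\mathcal X}h(x,\theta_0)\dot f(x,\theta_0)\,dx$, and $$\gamma_{n*}^{-1}\left[H(\widehat\theta_n)-H(\theta_0)\right]\xrightarrow{d}\nabla_\theta H(\theta_0)^\top Z^*,\qquad n\to\infty,$$ where $$\nabla_\theta H(\theta_0)=\int_{\mathcal X}\left[\dot h(x,\theta_0)f(x,\theta_0)+h(x,\theta_0)\dot f(x,\theta_0)\right]dx .$$
   Context: $(\Omega,\mathcal F,\mathbb P)$ is a probability space and $\Theta\subset\mathbb{R}^p$ is a parameter set with true value $\theta_0\in\Theta$. $h:\mathcal X\times\Theta\to\mathbb{R}$, $\dot h(x,\theta)=\nabla_\theta h(x,\theta)$ (gradient in $\theta$), and $H(\theta)=\mathbb{E}[h(X^\theta,\theta)]$ is the expected functional of interest. $\widehat\theta_n$ is an estimator of $\theta_0$ (a $\Theta$-valued random variable) computed from data indexed by $n\in\mathbb{N}$. $H(\widehat\theta_n)$ means the deterministic function $H$ evaluated at $\widehat\theta_n$; $\mathbb{E}[\cdots]|_{\theta=\widehat\theta_n}$ means that the expectation is first computed for deterministic $\theta$ and then evaluated at $\theta=\widehat\theta_n$. Densities are with respect to Lebesgue measure; $|\cdot|$ of a matrix is the Euclidean (Frobenius) norm. $\xrightarrow{d}$ is convergence in distribution, and $o_p(1)$ denotes convergence to $0$ in probability.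
   Formalization: Added, since the claim fails without them: Θ is convex near θ0; E[ḣ(X^θ',θ)] is jointly continuous in (θ',θ) at (θ0,θ0), not only on the diagonal; h(x,θ0)f̈(x,·) is absolutely integrable jointly over x and the segment from θ0 to each nearby θ. *)

theory Defs
  imports "HOL-Probability.Probability"
begin

text \<open>
  \<open>weak_conv_m\<close> of HOL-Probability covers only laws on the real line. The limit may live on its
  own probability space, since only its law matters. For real-valued variables this is equivalent to
  \<open>weak_conv_m\<close> of the laws.
\<close>

definition converges_in_distribution ::
  "'w measure \<Rightarrow> (nat \<Rightarrow> 'w \<Rightarrow> 'b::metric_space) \<Rightarrow> 'z measure \<Rightarrow> ('z \<Rightarrow> 'b) \<Rightarrow> bool" where
  "converges_in_distribution M Y N Z \<longleftrightarrow>
     (\<forall>n. Y n \<in> borel_measurable M) \<and> Z \<in> borel_measurable N \<and>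
     (\<forall>g :: 'b \<Rightarrow> real. continuous_on UNIV g \<and> bounded (range g) \<longrightarrow>
        (\<lambda>n. \<integral>\<omega>. g (Y n \<omega>) \<partial>M) \<longlonglongrightarrow> (\<integral>z. g (Z z) \<partial>N))"

definition small_op_one :: "'w measure \<Rightarrow> (nat \<Rightarrow> 'w \<Rightarrow> real) \<Rightarrow> bool" where
  "small_op_one M R \<longleftrightarrow>
     (\<forall>n. R n \<in> borel_measurable M) \<and>
     (\<forall>\<epsilon>>0. (\<lambda>n. measure M {\<omega> \<in> space M. \<bar>R n \<omega>\<bar> > \<epsilon>}) \<longlonglongrightarrow> 0)"

definition has_gradient_on ::
  "('v::real_inner \<Rightarrow> real) \<Rightarrow> 'v \<Rightarrow> 'v \<Rightarrow> 'v set \<Rightarrow> bool" where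
  "has_gradient_on \<phi> D \<theta> S \<longleftrightarrow> (\<phi> has_derivative (\<lambda>v. D \<bullet> v)) (at \<theta> within S)"

definition has_hessian_on ::
  "(real^'p \<Rightarrow> real^'p) \<Rightarrow> real^'p^'p \<Rightarrow> real^'p \<Rightarrow> (real^'p) set \<Rightarrow> bool" where
  \<comment> \<open>the first argument is the gradient field\<close>
  "has_hessian_on G A \<theta> S \<longleftrightarrow> (G has_derivative (\<lambda>v. A *v v)) (at \<theta> within S)"

definition diag_matrix :: "real^'p \<Rightarrow> real^'p^'p" where
  "diag_matrix v = (\<chi> i j. if i = j then v $ i else 0)"

definition max_entry :: "real^'p \<Rightarrow> real" where
  "max_entry v = (MAX k. v $ k)"

definition expect_at ::
  "'w measure \<Rightarrow> ('t \<Rightarrow> 'w \<Rightarrow> 'x) \<Rightarrow> ('x \<Rightarrow> 't \<Rightarrow> 'b::{banach, second_countable_topology}) \<Rightarrow> 't \<Rightarrow> 't \<Rightarrow> 'b"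
  where \<comment> \<open>\<open>E[g(X^\<theta>', \<theta>)]\<close>, with the two roles of the parameter separated\<close>
  "expect_at M X g \<theta>' \<theta> = (\<integral>\<omega>. g (X \<theta>' \<omega>) \<theta> \<partial>M)"

definition expected_functional ::
  "'w measure \<Rightarrow> ('t \<Rightarrow> 'w \<Rightarrow> 'x) \<Rightarrow> ('x \<Rightarrow> 't \<Rightarrow> real) \<Rightarrow> 't \<Rightarrow> real" where
  "expected_functional M X h \<theta> = expect_at M X h \<theta> \<theta>"

text \<open>
  Regularity needed in addition to the pointwise hypotheses.

  A second-order expansion at \<open>\<theta>0\<close> runs along the segments from \<open>\<theta>0\<close> to nearby points of \<open>\<Theta>\<close>,
  so these must lie in \<open>\<Theta>\<close>; this holds whenever \<open>\<Theta>\<close> is open, or \<open>\<Theta>\<close> is convex, or \<open>\<theta>0\<close> is an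
  interior point.
\<close>

definition locally_convex_at :: "(real^'p) set \<Rightarrow> real^'p \<Rightarrow> bool" where
  "locally_convex_at \<Theta> \<theta>0 \<longleftrightarrow> (\<exists>r>0. convex (\<Theta> \<inter> ball \<theta>0 r))"

text \<open>
  Fubini condition for the Taylor remainder. It imposes no bound uniform in \<open>\<theta>\<close>. Boundedness of
  \<open>\<integral> h f'' dx\<close> alone does not allow integrating the remainder: with \<open>w u = exp (- 1 / u)\<close>, a smooth
  density \<open>B\<close> and a density \<open>g\<close>, both with compact support, take \<open>h x = exp x\<close> and
  \<open>f x u = (1 - w u) * g x + w u * B (x - 1 / u)\<close> for \<open>u > 0\<close>, \<open>f x u = g x\<close> for \<open>u \<le> 0\<close>. For every
  \<open>x\<close> this is smooth in \<open>u\<close>, the integrals of \<open>h\<close> against the first and second derivatives are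
  bounded near \<open>0\<close>, and yet \<open>\<integral> h x * f x u dx\<close> jumps at \<open>u = 0\<close>.
\<close>

definition fubini_remainder_at ::
  "(real^'d \<Rightarrow> real) \<Rightarrow> (real^'d \<Rightarrow> real^'p \<Rightarrow> real^'p^'p) \<Rightarrow> (real^'p) set \<Rightarrow> real^'p \<Rightarrow> bool" where
  "fubini_remainder_at k fdd \<Theta> \<theta>0 \<longleftrightarrow>
     (\<forall>\<^sub>F \<theta> in at \<theta>0 within \<Theta>.
        set_integrable (lborel \<Otimes>\<^sub>M lborel) (UNIV \<times> {0..1::real})
          (\<lambda>(x, u). k x *\<^sub>R fdd x (\<theta>0 + u *\<^sub>R (\<theta> - \<theta>0))))"

end

theory Submission
  imports Defs
begin

text \<open>
  With \<open>G \<theta> = E[h(X^\<theta>, \<theta>0)]\<close>, integrate the second-order Taylor formula for \<open>f x\<close> along the segment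
  from \<open>\<theta>0\<close> to \<open>\<theta>\<close> against \<open>h x \<theta>0\<close>. Swapping the two integrals in the remainder turns the bound on
  \<open>\<integral> h f'' dx\<close> into \<open>G \<theta> - G \<theta>0 - C \<bullet> (\<theta> - \<theta>0) = O(|\<theta> - \<theta>0|\<^sup>2)\<close>, so \<open>G\<close> has gradient \<open>C\<close> at \<open>\<theta>0\<close>.
  The mean value theorem in the second argument of \<open>E[h(X^\<theta>', \<theta>)]\<close> then yields the gradient of \<open>H\<close>
  by joint continuity. Both conclusions follow by the delta method: the rescaled errors are tight, so
  a remainder \<open>o(|\<theta> - \<theta>0|)\<close> becomes \<open>o_p(1)\<close> after rescaling, and Slutsky's lemma applies.

  Measurability of \<open>G\<close> and \<open>H\<close> at the estimator comes from Caratheodory integrands: \<open>h\<close> and \<open>f\<close> are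
  measurable in \<open>x\<close> and continuous in the parameter. The parameter set need not be Borel, hence the
  restricted \<open>\<sigma>\<close>-algebra.
\<close>

section \<open>Joint measurability in the parameter and the observation\<close>

text \<open>Replacing \<theta> by a point of a countable dense subset of \<open>S\<close> at
  distance below 1/(m+1) gives a function that depends on \<theta> only through a countable index.
  Continuity on \<open>S\<close> makes these functions converge pointwise to
  \<open>F x \<theta>\<close>. The dense set is taken inside \<open>S\<close>, where
  \<open>F\<close> is measurable in \<open>x\<close>.\<close>

lemma Caratheodory_measurable:
  fixes F :: "'a \<Rightarrow> 'b::{metric_space,second_countable_topology} \<Rightarrow> 'c::metric_space"
  assumes meas: "\<And>\<theta>. \<theta> \<in> S \<Longrightarrow> (\<lambda>x. F x \<theta>) \<in> borel_measurable M"
    and cont: "\<And>x. x \<in> space M \<Longrightarrow> continuous_on S (F x)"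
  shows "(\<lambda>(\<theta>, x). F x \<theta>) \<in> borel_measurable (restrict_space borel S \<Otimes>\<^sub>M M)"
proof (cases "S = {}")
  case True
  then show ?thesis
    by (intro measurableI) (auto simp: space_pair_measure space_restrict_space)
next
  case False
  obtain T where T: "countable T" "T \<subseteq> S" "S \<subseteq> closure T"
    by (rule separable)
  with False have "T \<noteq> {}" by auto
  define d where "d = from_nat_into T"
  have d_in: "d i \<in> S" for i
    using from_nat_into[OF \<open>T \<noteq> {}\<close>] T by (auto simp: d_def)
  \<comment> \<open>Any index with this distance bound would do for the convergence; the least one
    is a measurable function of \<theta>, because each condition on the distance cuts out a
    relatively open set.\<close>
  define k where "k m \<theta> = (LEAST i. dist (d i) \<theta> < 1 / real (Suc m))" for m :: nat and \<theta>
  have k: "dist (d (k m \<theta>)) \<theta> < 1 / real (Suc m)" if "\<theta> \<in> S" for m \<theta>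
  proof -
    have "\<theta> \<in> closure T" using that T by auto
    then obtain t where "t \<in> T" "dist t \<theta> < 1 / real (Suc m)"
      unfolding closure_approachable by (meson of_nat_0_less_iff zero_less_Suc zero_less_divide_1_iff)
    then have "\<exists>i. dist (d i) \<theta> < 1 / real (Suc m)"
      using from_nat_into_surj[OF \<open>countable T\<close>] by (metis d_def)
    then show ?thesis
      unfolding k_def by (rule LeastI_ex)
  qed
  let ?P = "restrict_space borel S \<Otimes>\<^sub>M M"
  have fst_meas[measurable]: "fst \<in> borel_measurable ?P"
    by (rule measurable_compose[OF measurable_fst]) (simp add: measurable_restrict_space1)
  show ?thesis
  proof (rule borel_measurable_LIMSEQ_metric)
    fix m
    show "(\<lambda>p. F (snd p) (d (k m (fst p)))) \<in> borel_measurable ?P"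
    \<comment> \<open>With the index frozen at \<open>i\<close>, only a function of the second
      coordinate remains; the countably many pieces are glued along the measurable index.\<close>
    proof (rule measurable_compose_countable[where g = "\<lambda>p. k m (fst p)"])
      show "(\<lambda>p. F (snd p) (d i)) \<in> borel_measurable ?P" for i
        by (rule measurable_compose[OF measurable_snd meas[OF d_in]])
      show "(\<lambda>p. k m (fst p)) \<in> ?P \<rightarrow>\<^sub>M count_space UNIV"
        unfolding k_def by measurable
    qed
  next
    fix p assume "p \<in> space ?P"
    then obtain \<theta> x where p: "p = (\<theta>, x)" "\<theta> \<in> S" "x \<in> space M"
      by (auto simp: space_pair_measure space_restrict_space)
    have "(\<lambda>m. dist (d (k m \<theta>)) \<theta>) \<longlonglongrightarrow> 0"
      by (rule tendsto_sandwich[OF _ _ tendsto_const LIMSEQ_Suc[OF lim_1_over_n]])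
        (auto intro!: always_eventually less_imp_le k[OF p(2), simplified])
    then have "(\<lambda>m. d (k m \<theta>)) \<longlonglongrightarrow> \<theta>"
      by (simp add: tendsto_dist_iff[of _ \<theta>])
    then have "(\<lambda>m. F x (d (k m \<theta>))) \<longlonglongrightarrow> F x \<theta>"
      using cont[OF p(3)] p(2) d_in
      by (intro continuous_on_tendsto_compose[where f = "F x" and s = S]) auto
    then show "(\<lambda>m. F (snd p) (d (k m (fst p)))) \<longlonglongrightarrow> (case p of (\<theta>, x) \<Rightarrow> F x \<theta>)"
      by (simp add: p)
  qed
qed

section \<open>Tightness, the delta method and Slutsky's lemma\<close>

text \<open>The single limit law has small tails by continuity from above. A continuous cutoff lying
  between the indicators of two nested tails carries this over to \<open>Y n\<close> for large
  \<open>n\<close>.\<close>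

lemma converges_in_distribution_tight:
  fixes Y :: "nat \<Rightarrow> 'w \<Rightarrow> 'b::real_normed_vector"
  assumes "prob_space M" "prob_space N" and conv: "converges_in_distribution M Y N Z"
    and "\<epsilon> > 0"
  shows "\<exists>K>0. \<forall>\<^sub>F n in sequentially. measure M {\<omega> \<in> space M. norm (Y n \<omega>) > K} < \<epsilon>"
proof -
  interpret M: prob_space M by fact
  interpret N: prob_space N by fact
  have [measurable]: "Y n \<in> borel_measurable M" for n
    using conv by (simp add: converges_in_distribution_def)
  have [measurable]: "Z \<in> borel_measurable N"
    using conv by (simp add: converges_in_distribution_def)
  have "(\<lambda>m. measure N {z \<in> space N. norm (Z z) > real m}) \<longlonglongrightarrow>
      measure N (\<Inter>m. {z \<in> space N. norm (Z z) > real m})"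
    by (rule N.finite_Lim_measure_decseq) (auto simp: decseq_def)
  also have "(\<Inter>m. {z \<in> space N. norm (Z z) > real m}) = {}"
  proof (intro equals0I)
    fix z assume z: "z \<in> (\<Inter>m. {z \<in> space N. norm (Z z) > real m})"
    obtain m where "norm (Z z) < real m" using reals_Archimedean2 by blast
    moreover have "real m < norm (Z z)" using z by blast
    ultimately show False by simp
  qed
  finally have "\<forall>\<^sub>F m in sequentially. measure N {z \<in> space N. norm (Z z) > real m} < \<epsilon>"
    using \<open>\<epsilon> > 0\<close> by (auto dest: order_tendstoD)
  then obtain m where m: "measure N {z \<in> space N. norm (Z z) > real m} < \<epsilon>"
    by (auto simp: eventually_sequentially)
  \<comment> \<open>The cutoff vanishes where the norm is at most \<open>m\<close> and equals 1
    where it is at least \<open>m + 1\<close>. Hence its mean under the limit is at most the tail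
    beyond \<open>m\<close>, and its mean under \<open>Y n\<close> is at least the tail beyond
    \<open>m + 1\<close>.\<close>
  define g :: "'b \<Rightarrow> real" where "g y = max 0 (min 1 (norm y - real m))" for y
  have g_cont: "continuous_on UNIV g"
    unfolding g_def by (intro continuous_intros)
  have [measurable]: "g \<in> borel_measurable borel"
    using g_cont by (rule borel_measurable_continuous_onI)
  have g01: "0 \<le> g y" "g y \<le> 1" for y by (auto simp: g_def)
  have "bounded (range g)"
    using g01 by (intro boundedI[of _ 1]) auto
  with g_cont conv have "(\<lambda>n. \<integral>\<omega>. g (Y n \<omega>) \<partial>M) \<longlonglongrightarrow> (\<integral>z. g (Z z) \<partial>N)"
    by (auto simp: converges_in_distribution_def)
  moreover have "(\<integral>z. g (Z z) \<partial>N) \<le> measure N {z \<in> space N. norm (Z z) > real m}"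
  proof -
    have "(\<integral>z. g (Z z) \<partial>N) \<le> (\<integral>z. indicator {z \<in> space N. norm (Z z) > real m} z \<partial>N)"
      by (intro integral_mono N.integrable_const_bound[where B = 1])
        (use g01 in \<open>auto simp: g_def indicator_def\<close>)
    then show ?thesis by simp
  qed
  ultimately have ev: "\<forall>\<^sub>F n in sequentially. (\<integral>\<omega>. g (Y n \<omega>) \<partial>M) < \<epsilon>"
    using order_tendstoD(2) le_less_trans[OF _ m] by blast
  have le: "measure M {\<omega> \<in> space M. norm (Y n \<omega>) > real m + 1} \<le> (\<integral>\<omega>. g (Y n \<omega>) \<partial>M)" for n
  proof -
    have "(\<integral>\<omega>. indicator {\<omega> \<in> space M. norm (Y n \<omega>) > real m + 1} \<omega> \<partial>M) \<le> (\<integral>\<omega>. g (Y n \<omega>) \<partial>M)"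
      by (intro integral_mono M.integrable_const_bound[where B = 1])
        (use g01 in \<open>auto simp: g_def indicator_def\<close>)
    then show ?thesis by simp
  qed
  show ?thesis
    using ev by (intro exI[of _ "real m + 1"] conjI) (auto elim!: eventually_mono intro: le_less_trans[OF le])
qed

text \<open>Where the rescaled error is at most \<open>K\<close>, the estimator is within
  \<open>K * a n\<close> of \<theta>0, so differentiability bounds the remainder by a small multiple
  of \<open>a n\<close>. The complementary event has small probability by tightness.\<close>

lemma small_op_one_delta_method:
  fixes \<theta>hat :: "nat \<Rightarrow> 'w \<Rightarrow> 'v::{euclidean_space}"
  assumes M: "prob_space M" "prob_space N"
    and conv: "converges_in_distribution M (\<lambda>n \<omega>. inverse (a n) *\<^sub>R (\<theta>hat n \<omega> - \<theta>0)) N Z"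
    and a: "\<And>n. a n > 0" "a \<longlonglongrightarrow> 0"
    and S: "\<And>n \<omega>. \<omega> \<in> space M \<Longrightarrow> \<theta>hat n \<omega> \<in> S"
    and \<phi>: "has_gradient_on \<phi> D \<theta>0 S"
    and meas: "\<And>n. (\<lambda>\<omega>. \<phi> (\<theta>hat n \<omega>)) \<in> borel_measurable M"
  shows "small_op_one M (\<lambda>n \<omega>. inverse (a n) * (\<phi> (\<theta>hat n \<omega>) - \<phi> \<theta>0)
    - D \<bullet> (inverse (a n) *\<^sub>R (\<theta>hat n \<omega> - \<theta>0)))" (is "small_op_one M ?R")
  unfolding small_op_one_def
proof (intro conjI allI impI)
  interpret M: prob_space M by fact
  have Y[measurable]: "(\<lambda>\<omega>. inverse (a n) *\<^sub>R (\<theta>hat n \<omega> - \<theta>0)) \<in> borel_measurable M" for n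
    using conv by (simp add: converges_in_distribution_def)
  show "?R n \<in> borel_measurable M" for n
    using meas[of n] Y[of n] by measurable
  fix \<epsilon> :: real assume "\<epsilon> > 0"
  show "(\<lambda>n. measure M {\<omega> \<in> space M. \<bar>?R n \<omega>\<bar> > \<epsilon>}) \<longlonglongrightarrow> 0"
  proof (rule order_tendstoI)
    fix \<eta> :: real assume "\<eta> > 0"
    obtain K where K: "K > 0" "\<forall>\<^sub>F n in sequentially.
        measure M {\<omega> \<in> space M. norm (inverse (a n) *\<^sub>R (\<theta>hat n \<omega> - \<theta>0)) > K} < \<eta>"
      using converges_in_distribution_tight[OF M conv \<open>\<eta> > 0\<close>] by auto
    \<comment> \<open>The tolerance \<epsilon> / K in the derivative cancels the factor
      \<open>K\<close> in the bound \<open>K * a n\<close> on the error, leaving exactly \<epsilon>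
      after division by \<open>a n\<close>.\<close>
    have "\<epsilon> / K > 0" using \<open>\<epsilon> > 0\<close> K by simp
    then obtain d where d: "d > 0" "\<And>y. y \<in> S \<Longrightarrow> norm (y - \<theta>0) < d \<Longrightarrow>
        norm (\<phi> y - \<phi> \<theta>0 - D \<bullet> (y - \<theta>0)) \<le> \<epsilon> / K * norm (y - \<theta>0)"
      using \<phi> unfolding has_gradient_on_def has_derivative_within_alt by blast
    have "d / K > 0" using d K by simp
    then have "\<forall>\<^sub>F n in sequentially. a n < d / K"
      using a(2) by (auto dest: order_tendstoD)
    with K(2) show "\<forall>\<^sub>F n in sequentially. measure M {\<omega> \<in> space M. \<bar>?R n \<omega>\<bar> > \<epsilon>} < \<eta>"
    proof eventually_elim
      case (elim n)
      have "\<bar>?R n \<omega>\<bar> \<le> \<epsilon>"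
        if "\<omega> \<in> space M" and Yn: "norm (inverse (a n) *\<^sub>R (\<theta>hat n \<omega> - \<theta>0)) \<le> K" for \<omega>
      proof -
        let ?v = "\<theta>hat n \<omega> - \<theta>0"
        have nv: "norm ?v \<le> K * a n"
        proof -
          have "norm ?v / a n \<le> K"
            using Yn a(1)[of n] by (simp add: divide_inverse mult.commute)
          then show ?thesis using a(1)[of n] by (simp add: field_simps)
        qed
        also have "\<dots> < d" using elim(2) K(1) by (simp add: field_simps)
        finally have "\<bar>\<phi> (\<theta>hat n \<omega>) - \<phi> \<theta>0 - D \<bullet> ?v\<bar> \<le> \<epsilon> / K * norm ?v"
          using d(2)[OF S[OF that(1)]] by simp
        also have "\<dots> \<le> \<epsilon> / K * (K * a n)"
          using nv \<open>\<epsilon> / K > 0\<close> by (intro mult_left_mono) auto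
        finally have *: "\<bar>\<phi> (\<theta>hat n \<omega>) - \<phi> \<theta>0 - D \<bullet> ?v\<bar> \<le> \<epsilon> * a n" using K(1) by simp
        have "?R n \<omega> = (\<phi> (\<theta>hat n \<omega>) - \<phi> \<theta>0 - D \<bullet> ?v) / a n"
          by (simp add: divide_inverse algebra_simps)
        with * a(1)[of n] show ?thesis by (simp add: pos_divide_le_eq)
      qed
      then have "{\<omega> \<in> space M. \<bar>?R n \<omega>\<bar> > \<epsilon>} \<subseteq>
          {\<omega> \<in> space M. norm (inverse (a n) *\<^sub>R (\<theta>hat n \<omega> - \<theta>0)) > K}"
        by (intro Collect_mono impI) (meson not_le)
      then have "measure M {\<omega> \<in> space M. \<bar>?R n \<omega>\<bar> > \<epsilon>} \<le>
          measure M {\<omega> \<in> space M. norm (inverse (a n) *\<^sub>R (\<theta>hat n \<omega> - \<theta>0)) > K}"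
        by (rule M.finite_measure_mono) measurable
      with elim(1) show ?case by simp
    qed
  qed (auto intro!: always_eventually less_le_trans[OF _ measure_nonneg])
qed

lemma converges_in_distribution_continuous_map:
  fixes \<phi> :: "'b::metric_space \<Rightarrow> 'c::metric_space"
  assumes conv: "converges_in_distribution M Y N Z" and \<phi>: "continuous_on UNIV \<phi>"
  shows "converges_in_distribution M (\<lambda>n \<omega>. \<phi> (Y n \<omega>)) N (\<lambda>z. \<phi> (Z z))"
proof -
  have "\<phi> \<in> borel_measurable borel"
    using \<phi> by (rule borel_measurable_continuous_onI)
  moreover have "continuous_on UNIV (\<lambda>y. g (\<phi> y))" "bounded (range (\<lambda>y. g (\<phi> y)))"
    if g: "continuous_on UNIV g" "bounded (range g)" for g :: "'c \<Rightarrow> real"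
    using continuous_on_compose2[OF g(1) \<phi>] by (auto intro: bounded_subset[OF g(2)])
  ultimately show ?thesis
    using conv unfolding converges_in_distribution_def
    by (auto intro: measurable_compose)
qed

text \<open>A test function \<open>g\<close> is only continuous, so a small \<open>R n\<close> need
  not move \<open>g (W n)\<close> little everywhere. Tightness confines \<open>W n\<close> to a
  compact interval, where \<open>g\<close> is uniformly continuous; the exceptional events are paid
  for with the bound on \<open>g\<close>.\<close>

lemma converges_in_distribution_Slutsky:
  fixes W :: "nat \<Rightarrow> 'w \<Rightarrow> real"
  assumes M: "prob_space M" "prob_space N"
    and conv: "converges_in_distribution M W N Z" and R: "small_op_one M R"
  shows "converges_in_distribution M (\<lambda>n \<omega>. W n \<omega> + R n \<omega>) N Z"
  unfolding converges_in_distribution_def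
proof (intro conjI allI impI)
  interpret M: prob_space M by fact
  have [measurable]: "W n \<in> borel_measurable M" for n
    using conv by (simp add: converges_in_distribution_def)
  have [measurable]: "R n \<in> borel_measurable M" for n
    using R by (simp add: small_op_one_def)
  show "(\<lambda>\<omega>. W n \<omega> + R n \<omega>) \<in> borel_measurable M" for n by measurable
  show "Z \<in> borel_measurable N"
    using conv by (simp add: converges_in_distribution_def)
  fix g :: "real \<Rightarrow> real" assume g: "continuous_on UNIV g \<and> bounded (range g)"
  then have [measurable]: "g \<in> borel_measurable borel"
    by (auto intro: borel_measurable_continuous_onI)
  obtain B where B: "B > 0" "\<And>x. \<bar>g x\<bar> \<le> B"
    using g by (auto simp: bounded_pos)
  have "(\<lambda>n. (\<integral>\<omega>. g (W n \<omega> + R n \<omega>) \<partial>M) - (\<integral>\<omega>. g (W n \<omega>) \<partial>M)) \<longlonglongrightarrow> 0"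
  proof (rule tendsto_norm_zero_cancel, rule order_tendstoI)
    fix \<epsilon> :: real assume "\<epsilon> > 0"
    \<comment> \<open>Each of the two exceptional events costs at most 2B times its probability,
      that is, less than \<epsilon> / 4; uniform continuity accounts for the other \<epsilon> /
      2.\<close>
    then have "\<epsilon> / (8 * B) > 0" using B by simp
    from converges_in_distribution_tight[OF M conv this]
    obtain K where K: "K > 0"
      "\<forall>\<^sub>F n in sequentially. measure M {\<omega> \<in> space M. \<bar>W n \<omega>\<bar> > K} < \<epsilon> / (8 * B)" by auto
    \<comment> \<open>The margin 1 keeps \<open>W n \<omega> + R n \<omega>\<close> in the interval
      when \<open>W n \<omega>\<close> is in [-K, K], as \<delta> below is at most 1.\<close>
    have "uniformly_continuous_on {-K-1..K+1} g"
      using g by (intro compact_uniformly_continuous) (auto intro: continuous_on_subset)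
    then obtain d where d: "d > 0" "\<And>x y. x \<in> {-K-1..K+1} \<Longrightarrow> y \<in> {-K-1..K+1} \<Longrightarrow>
        dist y x < d \<Longrightarrow> dist (g y) (g x) < \<epsilon> / 2"
      unfolding uniformly_continuous_on_def using \<open>\<epsilon> > 0\<close> by (meson half_gt_zero)
    define \<delta> where "\<delta> = min (d / 2) 1"
    have "\<delta> > 0" "\<delta> < d" "\<delta> \<le> 1" using d(1) by (auto simp: \<delta>_def)
    have "(\<lambda>n. measure M {\<omega> \<in> space M. \<bar>R n \<omega>\<bar> > \<delta>}) \<longlonglongrightarrow> 0"
      using R \<open>\<delta> > 0\<close> by (simp add: small_op_one_def)
    then have "\<forall>\<^sub>F n in sequentially. measure M {\<omega> \<in> space M. \<bar>R n \<omega>\<bar> > \<delta>} < \<epsilon> / (8 * B)"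
      using \<open>\<epsilon> / (8 * B) > 0\<close> by (auto dest: order_tendstoD)
    with K(2) show "\<forall>\<^sub>F n in sequentially.
        norm ((\<integral>\<omega>. g (W n \<omega> + R n \<omega>) \<partial>M) - (\<integral>\<omega>. g (W n \<omega>) \<partial>M)) < \<epsilon>"
    proof eventually_elim
      case (elim n)
      let ?A = "{\<omega> \<in> space M. \<bar>W n \<omega>\<bar> > K}" and ?B = "{\<omega> \<in> space M. \<bar>R n \<omega>\<bar> > \<delta>}"
      have i1: "integrable M (\<lambda>\<omega>. g (W n \<omega> + R n \<omega>))" "integrable M (\<lambda>\<omega>. g (W n \<omega>))"
        by (auto intro!: M.integrable_const_bound[where B = B] simp: B)
      have iA: "integrable M (indicator ?A :: 'w \<Rightarrow> real)"
        and iB: "integrable M (indicator ?B :: 'w \<Rightarrow> real)"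
        by (auto simp: less_top[symmetric])
      have bound: "\<bar>g (W n \<omega> + R n \<omega>) - g (W n \<omega>)\<bar> \<le>
          \<epsilon> / 2 + 2 * B * indicator ?A \<omega> + 2 * B * indicator ?B \<omega>" if "\<omega> \<in> space M" for \<omega>
      proof (cases "\<omega> \<in> ?A \<union> ?B")
        case True
        have "\<bar>g (W n \<omega> + R n \<omega>) - g (W n \<omega>)\<bar> \<le> 2 * B"
          using B(2)[of "W n \<omega> + R n \<omega>"] B(2)[of "W n \<omega>"] by linarith
        with True B(1) \<open>\<epsilon> > 0\<close> show ?thesis by (auto simp: indicator_def)
      next
        case False
        then have "\<bar>W n \<omega>\<bar> \<le> K" "\<bar>R n \<omega>\<bar> \<le> \<delta>" using that by auto
        then have "dist (g (W n \<omega> + R n \<omega>)) (g (W n \<omega>)) < \<epsilon> / 2"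
          using \<open>\<delta> < d\<close> \<open>\<delta> \<le> 1\<close> by (intro d(2)) (auto simp: dist_real_def)
        then show ?thesis using B(1) by (simp add: dist_real_def indicator_def)
      qed
      have "norm ((\<integral>\<omega>. g (W n \<omega> + R n \<omega>) \<partial>M) - (\<integral>\<omega>. g (W n \<omega>) \<partial>M)) =
          \<bar>\<integral>\<omega>. g (W n \<omega> + R n \<omega>) - g (W n \<omega>) \<partial>M\<bar>"
        using i1 by simp
      also have "\<dots> \<le> (\<integral>\<omega>. \<bar>g (W n \<omega> + R n \<omega>) - g (W n \<omega>)\<bar> \<partial>M)"
        by (rule integral_abs_bound)
      also have "\<dots> \<le> (\<integral>\<omega>. \<epsilon> / 2 + 2 * B * indicator ?A \<omega> + 2 * B * indicator ?B \<omega> \<partial>M)"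
        using i1 iA iB bound
        by (intro integral_mono Bochner_Integration.integrable_add integrable_mult_right integrable_abs
            Bochner_Integration.integrable_diff) auto
      also have "\<dots> = \<epsilon> / 2 + 2 * B * measure M ?A + 2 * B * measure M ?B"
        using iA iB by (simp add: M.prob_space)
      also have "\<dots> < \<epsilon> / 2 + 2 * B * (\<epsilon> / (8 * B)) + 2 * B * (\<epsilon> / (8 * B))"
        using elim B(1) by (intro add_strict_mono add_strict_left_mono mult_strict_left_mono) auto
      also have "\<dots> = \<epsilon>" using B(1) by (simp add: field_simps)
      finally show ?case .
    qed
  qed (auto intro!: always_eventually less_le_trans[OF _ norm_ge_zero])
  from tendsto_add[OF this, of "\<lambda>n. \<integral>\<omega>. g (W n \<omega>) \<partial>M" "\<integral>z. g (Z z) \<partial>N"]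
  show "(\<lambda>n. \<integral>\<omega>. g (W n \<omega> + R n \<omega>) \<partial>M) \<longlonglongrightarrow> (\<integral>z. g (Z z) \<partial>N)"
    using conv g by (simp add: converges_in_distribution_def)
qed

section \<open>Measurability and negligibility at the estimator\<close>

text \<open>Integrating \<open>x\<close> out of a jointly measurable function leaves a measurable
  function of the parameter, which is then composed with \<open>T\<close> as a map into the trace of
  the Borel sets on \<open>S\<close>.\<close>

lemma borel_measurable_integral_at_estimator:
  fixes S :: "'b::{metric_space,second_countable_topology} set"
  assumes meas: "\<And>\<theta>. \<theta> \<in> S \<Longrightarrow> (\<lambda>x. F x \<theta> :: real) \<in> borel_measurable (borel :: 'x::euclidean_space measure)"
    and cont: "\<And>x. continuous_on S (F x)"
    and T: "T \<in> borel_measurable M" "\<And>\<omega>. \<omega> \<in> space M \<Longrightarrow> T \<omega> \<in> S"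
  shows "(\<lambda>\<omega>. \<integral>x. F x (T \<omega>) \<partial>lborel) \<in> borel_measurable M"
proof -
  have "(\<lambda>(\<theta>, x). F x \<theta>) \<in> borel_measurable (restrict_space borel S \<Otimes>\<^sub>M lborel)"
    using meas cont by (intro Caratheodory_measurable) auto
  then have "(\<lambda>\<theta>. \<integral>x. F x \<theta> \<partial>lborel) \<in> borel_measurable (restrict_space borel S)"
    by (rule lborel.borel_measurable_lebesgue_integral)
  moreover have "T \<in> M \<rightarrow>\<^sub>M restrict_space borel S"
    using T by (intro measurable_restrict_space2) auto
  ultimately show ?thesis
    by (rule measurable_compose[rotated])
qed

text \<open>The estimator is known to lie in \<Theta> only for points of \<open>space M\<close>, so
  formulas valid on \<Theta> can replace a remainder only there.\<close>

lemma small_op_one_cong: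
  assumes "\<And>n \<omega>. \<omega> \<in> space M \<Longrightarrow> R n \<omega> = R' n \<omega>"
  shows "small_op_one M R \<longleftrightarrow> small_op_one M R'"
proof -
  have "R n \<in> borel_measurable M \<longleftrightarrow> R' n \<in> borel_measurable M" for n
    using assms by (intro measurable_cong) auto
  moreover have "{\<omega> \<in> space M. \<bar>R n \<omega>\<bar> > \<epsilon>} = {\<omega> \<in> space M. \<bar>R' n \<omega>\<bar> > \<epsilon>}" for n \<epsilon>
    using assms by auto
  ultimately show ?thesis by (simp add: small_op_one_def)
qed

section \<open>Quadratic forms and the Taylor remainder along segments\<close>

text \<open>Cauchy-Schwarz in each row; the norm of a matrix is the Frobenius norm here.\<close>

lemma norm_matrix_vector_mult_le:
  fixes A :: "real^'n^'m"
  shows "norm (A *v x) \<le> norm A * norm x"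
proof -
  have "norm (A *v x) \<le> L2_set (\<lambda>i. norm (A $ i) * norm x) UNIV"
    unfolding norm_vec_def[of "A *v x"]
    by (intro L2_set_mono) (auto simp: matrix_vector_mul_component Cauchy_Schwarz_ineq2)
  also have "\<dots> = norm A * norm x"
    by (simp add: norm_vec_def[of A] L2_set_left_distrib)
  finally show ?thesis .
qed

lemma abs_quadratic_form_le:
  fixes A :: "real^'n^'n"
  shows "\<bar>v \<bullet> (A *v v)\<bar> \<le> norm A * (norm v)\<^sup>2"
proof -
  have "\<bar>v \<bullet> (A *v v)\<bar> \<le> norm v * norm (A *v v)"
    by (rule Cauchy_Schwarz_ineq2)
  also have "\<dots> \<le> norm v * (norm A * norm v)"
    by (intro mult_left_mono norm_matrix_vector_mult_le) simp
  finally show ?thesis by (simp add: power2_eq_square algebra_simps)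
qed

text \<open>Linearity is in the matrix, with the vector fixed: this lets the quadratic form be
  exchanged with the integral of the matrix of second derivatives.\<close>

lemma bounded_linear_quadratic_form:
  "bounded_linear (\<lambda>A :: real^'n^'n. v \<bullet> (A *v v))"
  by (rule bounded_linear_intro[where K = "(norm v)\<^sup>2"])
    (auto simp: matrix_vector_mult_add_rdistrib inner_add_right scaleR_matrix_vector_assoc[symmetric]
      abs_quadratic_form_le)

text \<open>The chain rule uses \<phi> only on the image of the segment, so a derivative within
  \<open>S\<close> is enough, and \<open>S\<close> may have no interior. At the endpoints the
  derivative is one-sided.\<close>

lemma has_vector_derivative_along_segment:
  assumes \<phi>: "(\<phi> has_derivative L) (at (a + u *\<^sub>R v) within S)"
    and S: "\<And>t. t \<in> {0..1} \<Longrightarrow> a + t *\<^sub>R v \<in> S"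
  shows "((\<lambda>t. \<phi> (a + t *\<^sub>R v)) has_vector_derivative L v) (at u within {0..1})"
proof -
  interpret L: bounded_linear L
    using \<phi> by (rule has_derivative_bounded_linear)
  have "((\<lambda>t. a + t *\<^sub>R v) has_derivative (\<lambda>t. t *\<^sub>R v)) (at u within {0..1})"
    by (auto intro!: derivative_eq_intros)
  then have "((\<lambda>t. \<phi> (a + t *\<^sub>R v)) has_derivative (\<lambda>t. L (t *\<^sub>R v))) (at u within {0..1})"
  proof (rule has_derivative_in_compose)
    show "(\<phi> has_derivative L) (at (a + u *\<^sub>R v) within (\<lambda>t. a + t *\<^sub>R v) ` {0..1})"
      by (rule has_derivative_subset[OF \<phi>]) (use S in auto)
  qed
  then show ?thesis
    by (simp add: has_vector_derivative_def L.scaleR)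
qed

lemma locally_convex_atD:
  assumes "locally_convex_at \<Theta> \<theta>0" "\<theta>0 \<in> \<Theta>"
  obtains r where "r > 0"
    "\<And>\<theta> u. \<lbrakk>\<theta> \<in> \<Theta>; dist \<theta> \<theta>0 < r; u \<in> {0..1}\<rbrakk> \<Longrightarrow> \<theta>0 + u *\<^sub>R (\<theta> - \<theta>0) \<in> \<Theta>"
proof -
  obtain r where r: "r > 0" "convex (\<Theta> \<inter> ball \<theta>0 r)"
    using assms by (auto simp: locally_convex_at_def)
  have "\<theta>0 + u *\<^sub>R (\<theta> - \<theta>0) \<in> \<Theta>" if "\<theta> \<in> \<Theta>" "dist \<theta> \<theta>0 < r" "u \<in> {0..1}" for \<theta> u
  proof -
    have "(1 - u) *\<^sub>R \<theta>0 + u *\<^sub>R \<theta> \<in> \<Theta> \<inter> ball \<theta>0 r"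
      using that r assms(2) by (intro convexD[OF r(2)]) (auto simp: dist_commute)
    then show ?thesis by (simp add: algebra_simps)
  qed
  with r(1) that show ?thesis by blast
qed

text \<open>The function \<open>\<phi> u + (1 - u) * \<phi>' u\<close> is a primitive, since the two
  terms with \<phi>' cancel. The gauge integral integrates every derivative, so \<phi>'' may be
  discontinuous.\<close>

lemma Taylor_remainder_has_integral:
  fixes \<phi> \<phi>' \<phi>'' :: "real \<Rightarrow> real"
  assumes "\<And>u. u \<in> {0..1} \<Longrightarrow> (\<phi> has_vector_derivative \<phi>' u) (at u within {0..1})"
    and "\<And>u. u \<in> {0..1} \<Longrightarrow> (\<phi>' has_vector_derivative \<phi>'' u) (at u within {0..1})"
  shows "((\<lambda>u. (1 - u) * \<phi>'' u) has_integral (\<phi> 1 - \<phi> 0 - \<phi>' 0)) {0..1}"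
proof -
  have "((\<lambda>u. \<phi> u + (1 - u) * \<phi>' u) has_vector_derivative (1 - u) * \<phi>'' u) (at u within {0..1})"
    if "u \<in> {0..1}" for u
    using assms[OF that]
    by (auto intro!: derivative_eq_intros simp: has_real_derivative_iff_has_vector_derivative[symmetric])
  from fundamental_theorem_of_calculus[OF zero_le_one this] show ?thesis by (simp add: algebra_simps)
qed

text \<open>The left side is the double integral of \<open>k x\<close> times the Taylor remainder.
  Integrating over \<open>x\<close> first moves the quadratic form outside the integral of the
  second derivative, whose norm is at most \<open>B\<close> at every point of the segment.\<close>

lemma integral_Taylor_remainder_le:
  fixes f :: "'x::euclidean_space \<Rightarrow> real^'p \<Rightarrow> real"
  assumes seg: "\<And>u. u \<in> {0..1} \<Longrightarrow> \<theta>0 + u *\<^sub>R (\<theta> - \<theta>0) \<in> \<Theta>"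
    and fdot: "\<And>x \<theta>. \<theta> \<in> \<Theta> \<Longrightarrow> has_gradient_on (f x) (fdot x \<theta>) \<theta> \<Theta>"
    and fddot: "\<And>x \<theta>. \<theta> \<in> \<Theta> \<Longrightarrow> has_hessian_on (fdot x) (fddot x \<theta>) \<theta> \<Theta>"
    and f_int: "integrable lborel (\<lambda>x. k x * f x \<theta>)" "integrable lborel (\<lambda>x. k x * f x \<theta>0)"
    and fdot_int: "integrable lborel (\<lambda>x. k x *\<^sub>R fdot x \<theta>0)"
    and fddot_int: "\<And>\<theta>. \<theta> \<in> \<Theta> \<Longrightarrow> integrable lborel (\<lambda>x. k x *\<^sub>R fddot x \<theta>)"
    and B: "\<And>\<theta>. \<theta> \<in> \<Theta> \<Longrightarrow> norm (\<integral>x. k x *\<^sub>R fddot x \<theta> \<partial>lborel) \<le> B"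
    and joint: "set_integrable (lborel \<Otimes>\<^sub>M lborel) (UNIV \<times> {0..1::real})
      (\<lambda>(x, u). k x *\<^sub>R fddot x (\<theta>0 + u *\<^sub>R (\<theta> - \<theta>0)))"
  shows "\<bar>(\<integral>x. k x * f x \<theta> \<partial>lborel) - (\<integral>x. k x * f x \<theta>0 \<partial>lborel)
    - (\<integral>x. k x *\<^sub>R fdot x \<theta>0 \<partial>lborel) \<bullet> (\<theta> - \<theta>0)\<bar> \<le> B * (norm (\<theta> - \<theta>0))\<^sup>2"
proof -
  define v where "v = \<theta> - \<theta>0"
  define L where "L A = v \<bullet> (A *v v)" for A :: "real^'p^'p"
  interpret L: bounded_linear L
    unfolding L_def by (rule bounded_linear_quadratic_form)
  define g where "g x u = indicator {0..1} u * (1 - u) * (k x * L (fddot x (\<theta>0 + u *\<^sub>R v)))"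
    for x :: 'x and u :: real
  let ?F = "\<lambda>p. L (indicator (UNIV \<times> {0..1}) p *\<^sub>R (k (fst p) *\<^sub>R fddot (fst p) (\<theta>0 + snd p *\<^sub>R v)))"
  have F_int: "integrable (lborel \<Otimes>\<^sub>M lborel) ?F"
    using joint unfolding set_integrable_def v_def
    by (intro integrable_bounded_linear[OF L.bounded_linear_axioms]) (simp add: case_prod_unfold)
  have g_int: "integrable (lborel \<Otimes>\<^sub>M lborel) (case_prod g)"
  \<comment> \<open>Both measurability and domination are inherited from \<open>?F\<close>: the
    integrand \<open>g\<close> is \<open>?F\<close> times the weight \<open>1 - u\<close>, which
    lies between 0 and 1 on the unit interval.\<close>
  proof (rule Bochner_Integration.integrable_bound[OF F_int])
    have "(\<lambda>p. indicator {0..1} (snd p) * (1 - snd p) * ?F p) \<in> borel_measurable (lborel \<Otimes>\<^sub>M lborel)"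
      using borel_measurable_integrable[OF F_int] by measurable
    also have "(\<lambda>p. indicator {0..1} (snd p) * (1 - snd p) * ?F p) = case_prod g"
      by (auto simp: g_def fun_eq_iff L.scaleR indicator_def)
    finally show "case_prod g \<in> borel_measurable (lborel \<Otimes>\<^sub>M lborel)" .
    show "AE p in lborel \<Otimes>\<^sub>M lborel. norm (case_prod g p) \<le> norm (?F p)"
      by (intro AE_I2) (auto simp: g_def L.scaleR indicator_def abs_mult intro!: mult_left_le_one_le)
  qed
  have fub: "(\<integral>u. (\<integral>x. g x u \<partial>lborel) \<partial>lborel) = (\<integral>x. (\<integral>u. g x u \<partial>lborel) \<partial>lborel)"
    by (rule lborel_pair.Fubini_integral[OF g_int])
  \<comment> \<open>Taylor's formula yields a gauge integral. Lebesgue integrability of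
    \<open>g x\<close> identifies it with the Bochner integral; by Fubini this is available for
    almost every \<open>x\<close>, which is enough under the outer integral.\<close>
  have inner_x: "(\<integral>u. g x u \<partial>lborel) = k x * (f x \<theta> - f x \<theta>0 - fdot x \<theta>0 \<bullet> v)"
    if "integrable lborel (g x)" for x
  proof -
    have "((\<lambda>u. (1 - u) * L (fddot x (\<theta>0 + u *\<^sub>R v))) has_integral
        (f x (\<theta>0 + 1 *\<^sub>R v) - f x (\<theta>0 + 0 *\<^sub>R v) - fdot x (\<theta>0 + 0 *\<^sub>R v) \<bullet> v)) {0..1}"
    proof (rule Taylor_remainder_has_integral)
      fix u :: real assume "u \<in> {0..1}"
      then have in_\<Theta>: "\<theta>0 + u *\<^sub>R v \<in> \<Theta>" using seg by (simp add: v_def)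
      show "((\<lambda>u. f x (\<theta>0 + u *\<^sub>R v)) has_vector_derivative fdot x (\<theta>0 + u *\<^sub>R v) \<bullet> v)
          (at u within {0..1})"
        using fdot[OF in_\<Theta>, of x] seg unfolding has_gradient_on_def v_def
        by (rule has_vector_derivative_along_segment)
      have "((\<lambda>u. fdot x (\<theta>0 + u *\<^sub>R v)) has_vector_derivative fddot x (\<theta>0 + u *\<^sub>R v) *v v)
          (at u within {0..1})"
        using fddot[OF in_\<Theta>, of x] seg unfolding has_hessian_on_def v_def
        by (rule has_vector_derivative_along_segment)
      from bounded_linear.has_vector_derivative[OF bounded_linear_inner_left this, of v]
      show "((\<lambda>u. fdot x (\<theta>0 + u *\<^sub>R v) \<bullet> v) has_vector_derivative L (fddot x (\<theta>0 + u *\<^sub>R v)))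
          (at u within {0..1})"
        by (simp add: L_def inner_commute)
    qed
    then have "((\<lambda>u. k x * ((1 - u) * L (fddot x (\<theta>0 + u *\<^sub>R v)))) has_integral
        k x * (f x \<theta> - f x \<theta>0 - fdot x \<theta>0 \<bullet> v)) {0..1}"
      by (intro has_integral_mult_right) (simp add: v_def)
    then have "((\<lambda>u. if u \<in> {0..1} then k x * ((1 - u) * L (fddot x (\<theta>0 + u *\<^sub>R v))) else 0)
        has_integral k x * (f x \<theta> - f x \<theta>0 - fdot x \<theta>0 \<bullet> v)) UNIV"
      by (simp only: has_integral_restrict_UNIV)
    also have "(\<lambda>u. if u \<in> {0..1} then k x * ((1 - u) * L (fddot x (\<theta>0 + u *\<^sub>R v))) else 0) = g x"
      by (auto simp: g_def fun_eq_iff)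
    finally show ?thesis
      using has_integral_integral_lborel[OF that] has_integral_unique by blast
  qed
  have i: "integrable lborel (\<lambda>x. k x *\<^sub>R fdot x \<theta>0 \<bullet> v)"
    using fdot_int by (rule integrable_inner_left)
  have "AE x in lborel. (\<integral>u. g x u \<partial>lborel) = k x * (f x \<theta> - f x \<theta>0 - fdot x \<theta>0 \<bullet> v)"
    using lborel_pair.AE_integrable_fst[OF g_int] by eventually_elim (rule inner_x)
  then have "(\<integral>x. (\<integral>u. g x u \<partial>lborel) \<partial>lborel) =
      (\<integral>x. k x * (f x \<theta> - f x \<theta>0 - fdot x \<theta>0 \<bullet> v) \<partial>lborel)"
    using lborel_pair.integrable_fst[OF g_int] f_int i
    by (intro integral_cong_AE) (auto simp: right_diff_distrib)
  also have "\<dots> = (\<integral>x. k x * f x \<theta> - k x * f x \<theta>0 - k x *\<^sub>R fdot x \<theta>0 \<bullet> v \<partial>lborel)"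
    by (simp add: right_diff_distrib)
  also have "\<dots> = (\<integral>x. k x * f x \<theta> \<partial>lborel) - (\<integral>x. k x * f x \<theta>0 \<partial>lborel)
      - (\<integral>x. k x *\<^sub>R fdot x \<theta>0 \<bullet> v \<partial>lborel)"
    using f_int i by (simp del: inner_scaleR_left)
  also have "(\<integral>x. k x *\<^sub>R fdot x \<theta>0 \<bullet> v \<partial>lborel) = (\<integral>x. k x *\<^sub>R fdot x \<theta>0 \<partial>lborel) \<bullet> v"
    using fdot_int by (rule integral_inner_left)
  finally have lhs: "(\<integral>x. (\<integral>u. g x u \<partial>lborel) \<partial>lborel) =
      (\<integral>x. k x * f x \<theta> \<partial>lborel) - (\<integral>x. k x * f x \<theta>0 \<partial>lborel)
      - (\<integral>x. k x *\<^sub>R fdot x \<theta>0 \<partial>lborel) \<bullet> v" .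
  have bound: "\<bar>\<integral>x. g x u \<partial>lborel\<bar> \<le> indicator {0..1} u * (B * (norm v)\<^sup>2)" for u
  proof (cases "u \<in> {0..1}")
    case True
    then have in_\<Theta>: "\<theta>0 + u *\<^sub>R v \<in> \<Theta>" using seg by (simp add: v_def)
    let ?I = "\<integral>x. k x *\<^sub>R fddot x (\<theta>0 + u *\<^sub>R v) \<partial>lborel"
    have "(\<integral>x. g x u \<partial>lborel) = (1 - u) * (\<integral>x. L (k x *\<^sub>R fddot x (\<theta>0 + u *\<^sub>R v)) \<partial>lborel)"
      using True by (simp add: g_def L.scaleR)
    also have "\<dots> = (1 - u) * L ?I"
      using fddot_int[OF in_\<Theta>] by (simp add: integral_bounded_linear[OF L.bounded_linear_axioms])
    finally have "\<bar>\<integral>x. g x u \<partial>lborel\<bar> = (1 - u) * \<bar>L ?I\<bar>"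
      using True by (simp add: abs_mult)
    \<comment> \<open>Estimating the weight by 1 instead of integrating it gives the constant
      \<open>B\<close> rather than \<open>B / 2\<close>; only the quadratic order matters.\<close>
    also have "\<dots> \<le> 1 * \<bar>L ?I\<bar>"
      using True by (intro mult_right_mono) auto
    also have "\<dots> \<le> norm ?I * (norm v)\<^sup>2"
      using abs_quadratic_form_le[of v ?I] by (simp add: L_def)
    also have "\<dots> \<le> B * (norm v)\<^sup>2"
      by (intro mult_right_mono B[OF in_\<Theta>]) simp
    finally show ?thesis using True by simp
  qed (simp add: g_def)
  have "\<bar>\<integral>u. (\<integral>x. g x u \<partial>lborel) \<partial>lborel\<bar> \<le> (\<integral>u. \<bar>\<integral>x. g x u \<partial>lborel\<bar> \<partial>lborel)"
    by (rule integral_abs_bound)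
  also have "\<dots> \<le> (\<integral>u. indicator {0..1::real} u * (B * (norm v)\<^sup>2) \<partial>lborel)"
    using lborel_pair.integrable_snd[OF g_int]
    by (intro integral_mono) (auto simp: bound)
  also have "\<dots> = B * (norm v)\<^sup>2" by simp
  finally show ?thesis
    by (simp only: fub lhs v_def)
qed

section \<open>Gradients from remainder bounds and along the diagonal\<close>

lemma has_gradient_on_quadratic_remainder:
  fixes \<phi> :: "'v::real_inner \<Rightarrow> real"
  assumes "\<forall>\<^sub>F \<theta> in at \<theta>0 within S. \<bar>\<phi> \<theta> - \<phi> \<theta>0 - D \<bullet> (\<theta> - \<theta>0)\<bar> \<le> B * (norm (\<theta> - \<theta>0))\<^sup>2"
  shows "has_gradient_on \<phi> D \<theta>0 S"
  unfolding has_gradient_on_def has_derivative_within_alt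
proof (intro conjI allI impI bounded_linear_inner_right)
  fix e :: real assume "e > 0"
  obtain d where d: "d > 0" "\<And>y. \<lbrakk>y \<in> S; y \<noteq> \<theta>0; dist y \<theta>0 < d\<rbrakk> \<Longrightarrow>
      \<bar>\<phi> y - \<phi> \<theta>0 - D \<bullet> (y - \<theta>0)\<bar> \<le> B * (norm (y - \<theta>0))\<^sup>2"
    using assms unfolding eventually_at by blast
  show "\<exists>d>0. \<forall>y\<in>S. norm (y - \<theta>0) < d \<longrightarrow>
      norm (\<phi> y - \<phi> \<theta>0 - D \<bullet> (y - \<theta>0)) \<le> e * norm (y - \<theta>0)"
  \<comment> \<open>Within the second radius, \<open>\<bar>B\<bar> * norm (y - \<theta>0)\<close>
    stays below \<open>e\<close>. The summand 1 keeps the denominator positive when \<open>B\<close>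
    is 0, and the absolute value covers a negative \<open>B\<close>.\<close>
  proof (intro exI[of _ "min d (e / (\<bar>B\<bar> + 1))"] conjI ballI impI)
    fix y assume y: "y \<in> S" "norm (y - \<theta>0) < min d (e / (\<bar>B\<bar> + 1))"
    show "norm (\<phi> y - \<phi> \<theta>0 - D \<bullet> (y - \<theta>0)) \<le> e * norm (y - \<theta>0)"
    proof (cases "y = \<theta>0")
      case False
      have "\<bar>B\<bar> * norm (y - \<theta>0) \<le> (\<bar>B\<bar> + 1) * norm (y - \<theta>0)"
        by (intro mult_right_mono) auto
      also have "\<dots> \<le> e"
        using y(2) by (simp add: pos_less_divide_eq mult.commute)
      finally have "\<bar>B\<bar> * norm (y - \<theta>0) \<le> e" .
      moreover have "B * norm (y - \<theta>0) \<le> \<bar>B\<bar> * norm (y - \<theta>0)"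
        by (intro mult_right_mono) auto
      ultimately have "B * norm (y - \<theta>0) * norm (y - \<theta>0) \<le> e * norm (y - \<theta>0)"
        by (intro mult_right_mono) auto
      with d(2)[OF y(1) False] y(2) show ?thesis
        by (simp add: dist_norm power2_eq_square mult.assoc)
    qed simp
  qed (use d(1) \<open>e > 0\<close> in \<open>simp add: add_nonneg_pos\<close>)
qed

text \<open>The increment along the diagonal is
  \<open>E \<theta> \<theta> - E \<theta> \<theta>0\<close> plus
  \<open>E \<theta> \<theta>0 - E \<theta>0 \<theta>0\<close>. The second part has gradient
  \<open>C\<close>. In the first, the mean value theorem gives a gradient at a pair whose two
  entries both move with \<theta>, so joint continuity at (\<theta>0, \<theta>0) is what identifies
  its limit.\<close>

lemma has_gradient_on_diagonal:
  fixes E :: "real^'p \<Rightarrow> real^'p \<Rightarrow> real"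
  assumes \<Theta>: "locally_convex_at \<Theta> \<theta>0" "\<theta>0 \<in> \<Theta>"
    and E: "\<And>\<theta>' \<theta>. \<lbrakk>\<theta>' \<in> \<Theta>; \<theta> \<in> \<Theta>\<rbrakk> \<Longrightarrow> has_gradient_on (E \<theta>') (E' \<theta>' \<theta>) \<theta> \<Theta>"
    and cont: "continuous (at (\<theta>0, \<theta>0) within \<Theta> \<times> \<Theta>) (\<lambda>(\<theta>', \<theta>). E' \<theta>' \<theta>)"
    and G: "has_gradient_on (\<lambda>\<theta>. E \<theta> \<theta>0) C \<theta>0 \<Theta>"
  shows "has_gradient_on (\<lambda>\<theta>. E \<theta> \<theta>) (E' \<theta>0 \<theta>0 + C) \<theta>0 \<Theta>"
proof -
  obtain r where r: "r > 0"
    "\<And>\<theta> u. \<lbrakk>\<theta> \<in> \<Theta>; dist \<theta> \<theta>0 < r; u \<in> {0..1}\<rbrakk> \<Longrightarrow> \<theta>0 + u *\<^sub>R (\<theta> - \<theta>0) \<in> \<Theta>"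
    using locally_convex_atD[OF \<Theta>] by blast
  have "((\<lambda>\<theta>. E \<theta> \<theta> - E \<theta> \<theta>0) has_derivative (\<lambda>v. E' \<theta>0 \<theta>0 \<bullet> v)) (at \<theta>0 within \<Theta>)"
    unfolding has_derivative_within_alt
  proof (intro conjI allI impI bounded_linear_inner_right)
    fix e :: real assume "e > 0"
    then obtain d where d: "d > 0" "\<And>\<theta>' \<theta>. \<lbrakk>\<theta>' \<in> \<Theta>; \<theta> \<in> \<Theta>; dist (\<theta>', \<theta>) (\<theta>0, \<theta>0) < d\<rbrakk> \<Longrightarrow>
        dist (E' \<theta>' \<theta>) (E' \<theta>0 \<theta>0) < e"
      using cont unfolding continuous_within_eps_delta by fastforce
    show "\<exists>d>0. \<forall>y\<in>\<Theta>. norm (y - \<theta>0) < d \<longrightarrow>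
        norm (E y y - E y \<theta>0 - (E \<theta>0 \<theta>0 - E \<theta>0 \<theta>0) - E' \<theta>0 \<theta>0 \<bullet> (y - \<theta>0)) \<le> e * norm (y - \<theta>0)"
    \<comment> \<open>The radius \<open>r\<close> keeps the segment in \<Theta>. Both entries of the
      pair (y, intermediate point) are within \<open>norm (y - \<theta>0)\<close> of \<theta>0, so
      \<open>d / 2\<close> puts the pair within \<open>d\<close> of (\<theta>0, \<theta>0).\<close>
    proof (intro exI[of _ "min r (d / 2)"] conjI ballI impI)
      fix y assume y: "y \<in> \<Theta>" "norm (y - \<theta>0) < min r (d / 2)"
      let ?v = "y - \<theta>0"
      have seg: "\<theta>0 + u *\<^sub>R ?v \<in> \<Theta>" if "u \<in> {0..1}" for u
        using r(2)[OF y(1) _ that] y(2) by (simp add: dist_norm)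
      have "((\<lambda>t. E y (\<theta>0 + t *\<^sub>R ?v)) has_derivative
          (\<lambda>t. t *\<^sub>R (E' y (\<theta>0 + u *\<^sub>R ?v) \<bullet> ?v))) (at u within {0..1})" if "0 \<le> u" "u \<le> 1" for u
        using has_vector_derivative_along_segment[OF E[OF y(1) seg, unfolded has_gradient_on_def] seg] that
        by (simp add: has_vector_derivative_def)
      from mvt_very_simple[OF zero_le_one this]
      obtain u where u: "u \<in> {0..1}" "E y y - E y \<theta>0 = E' y (\<theta>0 + u *\<^sub>R ?v) \<bullet> ?v"
        by auto
      have "norm (u *\<^sub>R ?v) \<le> norm ?v"
        using u(1) by (simp add: mult_left_le_one_le)
      moreover have "dist (y, \<theta>0 + u *\<^sub>R ?v) (\<theta>0, \<theta>0) \<le> norm ?v + norm (u *\<^sub>R ?v)"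
        using sqrt_sum_squares_le_sum[of "norm ?v" "norm (u *\<^sub>R ?v)"]
        by (simp add: dist_norm norm_Pair del: norm_scaleR)
      ultimately have "dist (y, \<theta>0 + u *\<^sub>R ?v) (\<theta>0, \<theta>0) < d"
        using y(2) by simp
      from d(2)[OF y(1) seg[OF u(1)] this]
      have "norm (E' y (\<theta>0 + u *\<^sub>R ?v) - E' \<theta>0 \<theta>0) \<le> e" by (simp add: dist_norm)
      then have "norm (E' y (\<theta>0 + u *\<^sub>R ?v) - E' \<theta>0 \<theta>0) * norm ?v \<le> e * norm ?v"
        by (intro mult_right_mono) auto
      moreover have "\<bar>(E' y (\<theta>0 + u *\<^sub>R ?v) - E' \<theta>0 \<theta>0) \<bullet> ?v\<bar> \<le>
          norm (E' y (\<theta>0 + u *\<^sub>R ?v) - E' \<theta>0 \<theta>0) * norm ?v"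
        by (rule Cauchy_Schwarz_ineq2)
      ultimately show "norm (E y y - E y \<theta>0 - (E \<theta>0 \<theta>0 - E \<theta>0 \<theta>0) - E' \<theta>0 \<theta>0 \<bullet> ?v) \<le> e * norm ?v"
        using u(2) by (simp add: inner_diff_left)
    qed (use r(1) d(1) in simp)
  qed
  from has_derivative_add[OF this G[unfolded has_gradient_on_def]] show ?thesis
    by (simp add: has_gradient_on_def inner_add_left)
qed

section \<open>Expansion and limit law at the estimator\<close>

theorem corollary2p1:
  fixes M :: "'w measure"
    and \<Theta> :: "(real^'p) set"
    and \<theta>0 :: "real^'p"
    and X :: "real^'p \<Rightarrow> 'w \<Rightarrow> real^'d"
    and h :: "real^'d \<Rightarrow> real^'p \<Rightarrow> real"
    and hdot :: "real^'d \<Rightarrow> real^'p \<Rightarrow> real^'p"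
    and f :: "real^'d \<Rightarrow> real^'p \<Rightarrow> real"
    and fdot :: "real^'d \<Rightarrow> real^'p \<Rightarrow> real^'p"
    and fddot :: "real^'d \<Rightarrow> real^'p \<Rightarrow> real^'p^'p"
    and \<theta>hat :: "nat \<Rightarrow> 'w \<Rightarrow> real^'p"
    and \<gamma> :: "nat \<Rightarrow> real^'p"
    and \<gamma>s :: "nat \<Rightarrow> real"
    and N :: "'z measure" and Z :: "'z \<Rightarrow> real^'p"
    and Ns :: "'zs measure" and Zs :: "'zs \<Rightarrow> real^'p"
    and C gradH :: "real^'p"
  assumes prob: "prob_space M" "prob_space N" "prob_space Ns"
    and \<theta>0: "\<theta>0 \<in> \<Theta>"
    and \<theta>hat: "\<And>n. \<theta>hat n \<in> borel_measurable M"
      "\<And>n \<omega>. \<omega> \<in> space M \<Longrightarrow> \<theta>hat n \<omega> \<in> \<Theta>"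
    and density_nonneg: "\<And>\<theta> x. \<theta> \<in> \<Theta> \<Longrightarrow> f x \<theta> \<ge> 0"
    and density: "\<And>\<theta>. \<theta> \<in> \<Theta> \<Longrightarrow> distributed M lborel (X \<theta>) (\<lambda>x. ennreal (f x \<theta>))"
    and h_meas: "\<And>\<theta>. \<theta> \<in> \<Theta> \<Longrightarrow> (\<lambda>x. h x \<theta>) \<in> borel_measurable borel"
    and hdot_meas: "\<And>\<theta>. \<theta> \<in> \<Theta> \<Longrightarrow> (\<lambda>x. hdot x \<theta>) \<in> borel_measurable borel"
    and hdot: "\<And>x \<theta>. \<theta> \<in> \<Theta> \<Longrightarrow> has_gradient_on (h x) (hdot x \<theta>) \<theta> \<Theta>"
    \<comment> \<open>(i)\<close>
    and h_integrable: "\<And>\<theta>' \<theta>. \<theta>' \<in> \<Theta> \<Longrightarrow> \<theta> \<in> \<Theta> \<Longrightarrow> integrable M (\<lambda>\<omega>. h (X \<theta>' \<omega>) \<theta>)"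
    and hdot_integrable: "\<And>\<theta>' \<theta>. \<theta>' \<in> \<Theta> \<Longrightarrow> \<theta> \<in> \<Theta> \<Longrightarrow> integrable M (\<lambda>\<omega>. hdot (X \<theta>' \<omega>) \<theta>)"
    and interchange: "\<And>\<theta>' \<theta>. \<theta>' \<in> \<Theta> \<Longrightarrow> \<theta> \<in> \<Theta> \<Longrightarrow>
      has_gradient_on (expect_at M X h \<theta>') (expect_at M X hdot \<theta>' \<theta>) \<theta> \<Theta>"
    and diag_cont: "continuous_on \<Theta> (\<lambda>\<theta>. expect_at M X hdot \<theta> \<theta>)"
    \<comment> \<open>(ii)\<close>
    and \<gamma>_pos: "\<And>n k. \<gamma> n $ k > 0"
    and \<gamma>s: "\<And>n. \<gamma>s n = max_entry (\<gamma> n)"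
    and \<gamma>s_decreasing: "decseq \<gamma>s" "\<gamma>s \<longlonglongrightarrow> 0"
    and conv_Z: "converges_in_distribution M
      (\<lambda>n \<omega>. matrix_inv (diag_matrix (\<gamma> n)) *v (\<theta>hat n \<omega> - \<theta>0)) N Z"
    and conv_Zs: "converges_in_distribution M
      (\<lambda>n \<omega>. inverse (\<gamma>s n) *\<^sub>R (\<theta>hat n \<omega> - \<theta>0)) Ns Zs"
    \<comment> \<open>(iii)\<close>
    and fdot: "\<And>x \<theta>. \<theta> \<in> \<Theta> \<Longrightarrow> has_gradient_on (f x) (fdot x \<theta>) \<theta> \<Theta>"
    and fddot: "\<And>x \<theta>. \<theta> \<in> \<Theta> \<Longrightarrow> has_hessian_on (fdot x) (fddot x \<theta>) \<theta> \<Theta>"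
    and fdot_integrable: "integrable lborel (\<lambda>x. h x \<theta>0 *\<^sub>R fdot x \<theta>0)"
    and fddot_integrable: "\<And>\<theta>. \<theta> \<in> \<Theta> \<Longrightarrow> integrable lborel (\<lambda>x. h x \<theta>0 *\<^sub>R fddot x \<theta>)"
    and fddot_bounded:
      "bdd_above ((\<lambda>\<theta>. norm (\<integral>x. h x \<theta>0 *\<^sub>R fddot x \<theta> \<partial>lborel)) ` \<Theta>)"
    \<comment> \<open>regularity left implicit in (i), (iii) and the choice of the parameter set\<close>
    and \<Theta>: "locally_convex_at \<Theta> \<theta>0"
    and joint_cont: "continuous (at (\<theta>0, \<theta>0) within \<Theta> \<times> \<Theta>)
      (\<lambda>(\<theta>', \<theta>). expect_at M X hdot \<theta>' \<theta>)"
    and fubini: "fubini_remainder_at (\<lambda>x. h x \<theta>0) fddot \<Theta> \<theta>0"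
    \<comment> \<open>constants of the conclusion\<close>
    and C: "C = (\<integral>x. h x \<theta>0 *\<^sub>R fdot x \<theta>0 \<partial>lborel)"
    and gradH: "gradH =
      (\<integral>x. f x \<theta>0 *\<^sub>R hdot x \<theta>0 + h x \<theta>0 *\<^sub>R fdot x \<theta>0 \<partial>lborel)"
  shows "small_op_one M (\<lambda>n \<omega>.
      inverse (\<gamma>s n) * (\<lambda>\<theta>. \<integral>\<omega>'. (h (X \<theta> \<omega>') \<theta>0 - h (X \<theta>0 \<omega>') \<theta>0) \<partial>M) (\<theta>hat n \<omega>)
        - C \<bullet> (inverse (\<gamma>s n) *\<^sub>R (\<theta>hat n \<omega> - \<theta>0)))
    \<and> has_gradient_on (expected_functional M X h) gradH \<theta>0 \<Theta>
    \<and> converges_in_distribution M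
      (\<lambda>n \<omega>. inverse (\<gamma>s n) *
        (expected_functional M X h (\<theta>hat n \<omega>) - expected_functional M X h \<theta>0))
      Ns (\<lambda>z. gradH \<bullet> Zs z)"
proof -
  have f_meas: "(\<lambda>x. f x \<theta>) \<in> borel_measurable borel" if "\<theta> \<in> \<Theta>" for \<theta>
    using distributed_real_measurable[OF _ density[OF that]] density_nonneg[OF that] by simp
  have E_h: "expect_at M X h \<theta>' \<theta> = (\<integral>x. h x \<theta> * f x \<theta>' \<partial>lborel)"
    and int_h: "integrable lborel (\<lambda>x. h x \<theta> * f x \<theta>')"
    if "\<theta>' \<in> \<Theta>" "\<theta> \<in> \<Theta>" for \<theta>' \<theta>
    using distributed_integral[OF density[OF that(1)], of "\<lambda>x. h x \<theta>"]
      distributed_integrable[OF density[OF that(1)], of "\<lambda>x. h x \<theta>"]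
      h_meas[OF that(2)] density_nonneg[OF that(1)] h_integrable[OF that]
    by (simp_all add: expect_at_def mult.commute)
  have \<gamma>s_pos: "\<gamma>s n > 0" for n
    unfolding \<gamma>s max_entry_def by (subst Max_gr_iff) (auto simp: \<gamma>_pos)

  define G where "G \<theta> = expect_at M X h \<theta> \<theta>0" for \<theta>
  have cont_h: "continuous_on \<Theta> (h x)" and cont_f: "continuous_on \<Theta> (f x)" for x
    using hdot fdot unfolding has_gradient_on_def
    by (auto intro!: has_derivative_continuous_on)

  \<comment> \<open>Nothing is known about how \<open>X \<theta> \<omega>\<close> depends on
    \<theta> for fixed \<omega>. Measurability is therefore shown for the integral against the
    density, which is continuous in \<theta>, and transferred by the equality valid on
    \<Theta>.\<close>
  have "(\<lambda>\<omega>. \<integral>x. h x \<theta>0 * f x (\<theta>hat n \<omega>) \<partial>lborel) \<in> borel_measurable M" for n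
    by (rule borel_measurable_integral_at_estimator[where S = \<Theta>])
      (auto intro!: borel_measurable_times h_meas f_meas \<theta>0 \<theta>hat continuous_intros cont_f)
  then have G_meas: "(\<lambda>\<omega>. G (\<theta>hat n \<omega>)) \<in> borel_measurable M" for n
    by (subst measurable_cong[of M _ "\<lambda>\<omega>. \<integral>x. h x \<theta>0 * f x (\<theta>hat n \<omega>) \<partial>lborel"])
      (auto simp: G_def E_h \<theta>0 \<theta>hat)
  have "(\<lambda>\<omega>. \<integral>x. h x (\<theta>hat n \<omega>) * f x (\<theta>hat n \<omega>) \<partial>lborel) \<in> borel_measurable M" for n
    by (rule borel_measurable_integral_at_estimator[where S = \<Theta> and F = "\<lambda>x \<theta>. h x \<theta> * f x \<theta>"])
      (auto intro!: borel_measurable_times h_meas f_meas \<theta>hat continuous_intros cont_h cont_f)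
  then have H_meas: "(\<lambda>\<omega>. expected_functional M X h (\<theta>hat n \<omega>)) \<in> borel_measurable M" for n
    by (subst measurable_cong[of M _ "\<lambda>\<omega>. \<integral>x. h x (\<theta>hat n \<omega>) * f x (\<theta>hat n \<omega>) \<partial>lborel"])
      (auto simp: expected_functional_def E_h \<theta>hat)

  have G_grad: "has_gradient_on G C \<theta>0 \<Theta>"
  proof -
    obtain B where B: "\<And>\<theta>. \<theta> \<in> \<Theta> \<Longrightarrow> norm (\<integral>x. h x \<theta>0 *\<^sub>R fddot x \<theta> \<partial>lborel) \<le> B"
      using fddot_bounded by (auto simp: bdd_above_def)
    obtain r where r: "r > 0"
      "\<And>\<theta> u. \<lbrakk>\<theta> \<in> \<Theta>; dist \<theta> \<theta>0 < r; u \<in> {0..1}\<rbrakk> \<Longrightarrow> \<theta>0 + u *\<^sub>R (\<theta> - \<theta>0) \<in> \<Theta>"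
      using locally_convex_atD[OF \<Theta> \<theta>0] by blast
    have "\<forall>\<^sub>F \<theta> in at \<theta>0 within \<Theta>. \<theta> \<in> \<Theta> \<and> dist \<theta> \<theta>0 < r"
      using r(1) by (auto simp: eventually_at)
    with fubini[unfolded fubini_remainder_at_def]
    have "\<forall>\<^sub>F \<theta> in at \<theta>0 within \<Theta>. \<bar>G \<theta> - G \<theta>0 - C \<bullet> (\<theta> - \<theta>0)\<bar> \<le> B * (norm (\<theta> - \<theta>0))\<^sup>2"
    proof eventually_elim
      case (elim \<theta>)
      then have \<theta>: "\<theta> \<in> \<Theta>" by simp
      show ?case
        unfolding G_def C E_h[OF \<theta> \<theta>0] E_h[OF \<theta>0 \<theta>0]
        by (rule integral_Taylor_remainder_le[where \<Theta> = \<Theta>,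
              OF _ fdot fddot int_h[OF \<theta> \<theta>0] int_h[OF \<theta>0 \<theta>0] fdot_integrable fddot_integrable B])
          (use elim r(2) in auto)
    qed
    then show ?thesis by (rule has_gradient_on_quadratic_remainder)
  qed

  \<comment> \<open>Since \<open>hdot\<close> is vector-valued, the change of variables passes
    through the law of \<open>X \<theta>0\<close> and its density. Integrability of both summands
    then splits the single integral defining \<open>gradH\<close>.\<close>
  have gradH_eq: "gradH = expect_at M X hdot \<theta>0 \<theta>0 + C"
  proof -
    have distr: "distr M lborel (X \<theta>0) = density lborel (\<lambda>x. ennreal (f x \<theta>0))"
      and X_meas: "X \<theta>0 \<in> M \<rightarrow>\<^sub>M lborel"
      using density[OF \<theta>0] by (auto simp: distributed_def)
    have hdot_lborel: "(\<lambda>x. hdot x \<theta>0) \<in> borel_measurable lborel"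
      and f_lborel: "(\<lambda>x. f x \<theta>0) \<in> borel_measurable lborel"
      using hdot_meas[OF \<theta>0] f_meas[OF \<theta>0] by simp_all
    have f0: "AE x in lborel. 0 \<le> f x \<theta>0" using density_nonneg[OF \<theta>0] by simp
    have "expect_at M X hdot \<theta>0 \<theta>0 = (\<integral>x. hdot x \<theta>0 \<partial>distr M lborel (X \<theta>0))"
      unfolding expect_at_def by (rule integral_distr[OF X_meas hdot_lborel, symmetric])
    also have "\<dots> = (\<integral>x. f x \<theta>0 *\<^sub>R hdot x \<theta>0 \<partial>lborel)"
      unfolding distr by (rule integral_density[OF hdot_lborel f_lborel f0])
    finally have E: "expect_at M X hdot \<theta>0 \<theta>0 = (\<integral>x. f x \<theta>0 *\<^sub>R hdot x \<theta>0 \<partial>lborel)" .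
    have "integrable (distr M lborel (X \<theta>0)) (\<lambda>x. hdot x \<theta>0)"
      using hdot_integrable[OF \<theta>0 \<theta>0] by (simp add: integrable_distr_eq[OF X_meas hdot_lborel])
    then have "integrable lborel (\<lambda>x. f x \<theta>0 *\<^sub>R hdot x \<theta>0)"
      unfolding distr by (simp add: integrable_density[OF hdot_lborel f_lborel f0])
    then show ?thesis
      unfolding gradH C E using fdot_integrable by simp
  qed
  have H_grad: "has_gradient_on (expected_functional M X h) gradH \<theta>0 \<Theta>"
    unfolding gradH_eq expected_functional_def[abs_def]
    using G_grad[unfolded G_def[abs_def]]
    by (intro has_gradient_on_diagonal[where E = "expect_at M X h" and E' = "expect_at M X hdot",
          OF \<Theta> \<theta>0 interchange joint_cont])

  \<comment> \<open>The same expansion serves twice: with \<open>G\<close> for the first conclusion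
    and with \<open>expected_functional M X h\<close> for the limit law.\<close>
  note delta = small_op_one_delta_method[OF prob(1,3) conv_Zs \<gamma>s_pos \<gamma>s_decreasing(2) \<theta>hat(2)]
  have "small_op_one M (\<lambda>n \<omega>.
      inverse (\<gamma>s n) * (\<lambda>\<theta>. \<integral>\<omega>'. (h (X \<theta> \<omega>') \<theta>0 - h (X \<theta>0 \<omega>') \<theta>0) \<partial>M) (\<theta>hat n \<omega>)
        - C \<bullet> (inverse (\<gamma>s n) *\<^sub>R (\<theta>hat n \<omega> - \<theta>0)))"
  proof -
    have "(\<integral>\<omega>'. (h (X \<theta> \<omega>') \<theta>0 - h (X \<theta>0 \<omega>') \<theta>0) \<partial>M) = G \<theta> - G \<theta>0" if "\<theta> \<in> \<Theta>" for \<theta>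
      using h_integrable[OF that \<theta>0] h_integrable[OF \<theta>0 \<theta>0] by (simp add: G_def expect_at_def)
    then show ?thesis
      using delta[OF _ G_grad G_meas]
      by (subst small_op_one_cong[where R' = "\<lambda>n \<omega>. inverse (\<gamma>s n) * (G (\<theta>hat n \<omega>) - G \<theta>0)
        - C \<bullet> (inverse (\<gamma>s n) *\<^sub>R (\<theta>hat n \<omega> - \<theta>0))"]) (auto simp: \<theta>hat)
  qed
  moreover have "converges_in_distribution M
      (\<lambda>n \<omega>. inverse (\<gamma>s n) *
        (expected_functional M X h (\<theta>hat n \<omega>) - expected_functional M X h \<theta>0))
      Ns (\<lambda>z. gradH \<bullet> Zs z)"
    \<comment> \<open>The rescaled increment of the functional is the inner product of
      \<open>gradH\<close> with the rescaled error, plus a remainder negligible in probability; the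
      inner product converges by continuous mapping.\<close>
    using converges_in_distribution_Slutsky[OF prob(1,3)
        converges_in_distribution_continuous_map[OF conv_Zs, of "\<lambda>y. gradH \<bullet> y"]
        delta[OF _ H_grad H_meas]]
    by (simp add: continuous_on_inner[OF continuous_on_const continuous_on_id])
  ultimately show ?thesis using H_grad by blast
qed

end
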